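(* Let $n\ge2$ and let $\mu$ be a Borel measure on the unit sphere $S^{n-1}$ satisfying $0<\mu(S^{n-1})<\infty$. If $$\mu(\{y\})<\tfrac12\,\mu(S^{n-1})\qquad\text{for all }y\in S^{n-1},$$ then a unique point $x=x(\mu)\in\mathbb{B}^n$ exists such that $$\int_{S^{n-1}}T_x(y)\,d\mu(y)=0.$$ That is, pushing forward the measure by $T_x$ results in a center of mass at the origin: $\int_{S^{n-1}}y\,d[(T_x)_*\mu](y)=0$. This point $x(\mu)$ depends continuously on the measure: if $\mu_k\to\mu$ weakly, where the $\mu_k$ are Borel measures on $S^{n-1}$ satisfying $0<\mu_k(S^{n-1})<\infty$ and $\mu_k(\{y\})<\frac12\mu_k(S^{n-1})$ for all $y\in S^{n-1}$, then $x(\mu_k)\to x(\mu)$ as $k\to\infty$.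
   Context: $\mathbb{B}^n$ is the open unit ball centered at the origin in $\mathbb{R}^n$, $\overline{\mathbb{B}^n}$ its closure, $S^{n-1}=\partial\mathbb{B}^n$. For $x\in\mathbb{B}^n$ the M\"obius transformation $T_x:\overline{\mathbb{B}^n}\to\overline{\mathbb{B}^n}$, which maps $S^{n-1}$ to itself, is $$T_x(y)=\frac{(1+2x\cdot y+|y|^2)x+(1-|x|^2)y}{1+2x\cdot y+|x|^2|y|^2},\qquad y\in\overline{\mathbb{B}^n}.$$ $(T_x)_*\mu$ denotes the pushforward measure. Weak convergence $\mu_k\to\mu$ means $\int\psi\,d\mu_k\to\int\psi\,d\mu$ for every continuous real function $\psi$ on $S^{n-1}$. *)

theory Defs
  imports "HOL-Analysis.Analysis"
begin

definition ball_moebius :: "real ^ 'n \<Rightarrow> real ^ 'n \<Rightarrow> real ^ 'n" where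
  "ball_moebius x y =
     ((1 + 2 * (x \<bullet> y) + (norm y)\<^sup>2) *\<^sub>R x + (1 - (norm x)\<^sup>2) *\<^sub>R y)
       /\<^sub>R (1 + 2 * (x \<bullet> y) + (norm x)\<^sup>2 * (norm y)\<^sup>2)"

text \<open>The measurable space of the sphere; its own measure values play no role.\<close>

definition sphere_borel :: "(real ^ 'n) measure" where
  "sphere_borel = restrict_space borel (sphere 0 1)"

text \<open>Equality of \<open>sets\<close> forces the underlying space to be the sphere.\<close>

definition sphere_measure :: "(real ^ 'n) measure \<Rightarrow> bool" where
  "sphere_measure \<mu> \<longleftrightarrow>
     sets \<mu> = sets sphere_borel \<and>
     0 < emeasure \<mu> (sphere 0 1) \<and> emeasure \<mu> (sphere 0 1) < \<infinity>"

definition atoms_below_half :: "(real ^ 'n) measure \<Rightarrow> bool" where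
  "atoms_below_half \<mu> \<longleftrightarrow>
     (\<forall>y \<in> sphere 0 1. emeasure \<mu> {y} < emeasure \<mu> (sphere 0 1) / 2)"

definition sphere_weak_conv ::
  "(nat \<Rightarrow> (real ^ 'n) measure) \<Rightarrow> (real ^ 'n) measure \<Rightarrow> bool" where
  "sphere_weak_conv \<mu>s \<mu> \<longleftrightarrow>
     (\<forall>\<psi> :: real ^ 'n \<Rightarrow> real. continuous_on (sphere 0 1) \<psi> \<longrightarrow>
        (\<lambda>k. LINT y|\<mu>s k. \<psi> y) \<longlonglongrightarrow> (LINT y|\<mu>. \<psi> y))"

definition moebius_center :: "(real ^ 'n) measure \<Rightarrow> real ^ 'n" where
  "moebius_center \<mu> = (THE x. x \<in> ball 0 1 \<and> (LINT y|\<mu>. ball_moebius x y) = 0)"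

text \<open>
  The next facts show that the totalised operations in these definitions are never
  applied outside their proper domain: for \<open>x\<close> in the open ball the denominator is
  positive, \<open>ball_moebius x\<close> is a measurable self-map of the sphere (so the pushforward
  \<open>distr\<close> is the genuine one), and the Bochner integral of \<open>ball_moebius x\<close> exists.
\<close>

lemma moebius_denominator_pos:
  fixes x y :: "real ^ 'n"
  assumes "x \<in> ball 0 1" "y \<in> cball 0 1"
  shows "0 < 1 + 2 * (x \<bullet> y) + (norm x)\<^sup>2 * (norm y)\<^sup>2"
proof -
  have "norm x * norm y \<le> norm x * 1"
    using assms by (intro mult_left_mono) auto
  then have "norm x * norm y < 1"
    using assms by simp
  then have "0 < (1 - norm x * norm y)\<^sup>2"
    by simp
  moreover have "- (norm x * norm y) \<le> x \<bullet> y"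
    using Cauchy_Schwarz_ineq2[of x y] by linarith
  ultimately show ?thesis
    by (simp add: power2_eq_square algebra_simps)
qed

lemma norm_moebius_sphere:
  fixes x y :: "real ^ 'n"
  assumes "x \<in> ball 0 1" "y \<in> sphere 0 1"
  shows "norm (ball_moebius x y) = 1"
proof -
  define d where "d = 1 + 2 * (x \<bullet> y) + (norm x)\<^sup>2"
  define v where "v = (2 + 2 * (x \<bullet> y)) *\<^sub>R x + (1 - (norm x)\<^sup>2) *\<^sub>R y"
  have d: "0 < d"
    using moebius_denominator_pos[of x y] assms by (simp add: d_def)
  have yy: "y \<bullet> y = 1"
    using assms by (simp flip: power2_norm_eq_inner)
  have "(norm v)\<^sup>2 = d\<^sup>2"
    unfolding v_def d_def power2_norm_eq_inner
    by (simp add: inner_add_left inner_add_right yy inner_commute[of y x])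
       (simp add: power2_eq_square algebra_simps)
  then have "norm v = d"
    using d by simp
  moreover have "ball_moebius x y = v /\<^sub>R d"
    using assms by (simp add: ball_moebius_def v_def d_def)
  ultimately show ?thesis
    using d by simp
qed

lemma continuous_on_moebius:
  fixes x :: "real ^ 'n"
  assumes "x \<in> ball 0 1"
  shows "continuous_on (cball 0 1) (ball_moebius x)"
  unfolding ball_moebius_def
  by (intro continuous_intros ballI) (use moebius_denominator_pos[OF assms] in force)

lemma measurable_moebius:
  fixes x :: "real ^ 'n"
  assumes "x \<in> ball 0 1"
  shows "ball_moebius x \<in> measurable sphere_borel sphere_borel"
proof -
  have "continuous_on (sphere 0 1) (ball_moebius x)"
    using continuous_on_moebius[OF assms] by (rule continuous_on_subset) auto
  then have "ball_moebius x \<in> borel_measurable (restrict_space borel (sphere 0 1))"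
    by (rule borel_measurable_continuous_on_restrict)
  then show ?thesis
    unfolding sphere_borel_def
    by (rule measurable_restrict_space2[rotated])
       (use norm_moebius_sphere[OF assms] in \<open>auto simp: space_restrict_space\<close>)
qed

lemma integrable_moebius:
  fixes x :: "real ^ 'n"
  assumes "sphere_measure \<mu>" "x \<in> ball 0 1"
  shows "integrable \<mu> (ball_moebius x)"
proof -
  have sets: "sets \<mu> = sets sphere_borel"
    using assms(1) by (simp add: sphere_measure_def)
  have space: "space \<mu> = sphere 0 1"
    using sets_eq_imp_space_eq[OF sets] by (simp add: sphere_borel_def space_restrict_space)
  interpret finite_measure \<mu>
    by standard (use assms(1) in \<open>auto simp: sphere_measure_def space\<close>)
  have "ball_moebius x \<in> measurable sphere_borel borel"
    using measurable_moebius[OF assms(2)]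
    unfolding sphere_borel_def by (simp add: measurable_restrict_space2_iff)
  then have "ball_moebius x \<in> borel_measurable \<mu>"
    by (simp cong: measurable_cong_sets add: sets)
  then show ?thesis
    by (intro integrable_const_bound[where B = 1] AE_I2)
       (use norm_moebius_sphere[OF assms(2)] in \<open>auto simp: space\<close>)
qed

end

theory Submission
  imports Defs
begin

text \<open>
  If \<open>x\<close> approaches a boundary point \<open>p\<close>, then \<open>ball_moebius x\<close> tends to \<open>p\<close> away from \<open>- p\<close>;
  since \<open>- p\<close> carries less than half of the mass, the center of mass \<open>F x\<close> of the pushforward
  satisfies \<open>F x \<bullet> x > 0\<close>, uniformly along weakly convergent measures. So \<open>F\<close> points outward on a
  sphere close to the boundary and has a zero by Brouwer's theorem, and zeros for a weakly
  convergent sequence of measures cannot escape to the boundary, which together with uniqueness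
  gives continuity.

  For uniqueness, the zeros are the critical points of the integral of
  \<open>ln ((norm (x + y))\<^sup>2 / (1 - (norm x)\<^sup>2))\<close>, which is convex along hyperbolic geodesics. Adding
  the critical point equations at two points, each tested in the direction of the other, expresses
  as zero the integral of a nonnegative function that vanishes only at the two ideal
  end points of the geodesic through \<open>- x\<close> and \<open>- z\<close>.
\<close>

section \<open>The Moebius map and finite measures on the sphere\<close>

lemma norm_add_sphere_square:
  fixes x y :: "'a :: real_inner"
  assumes "y \<in> sphere 0 1"
  shows "(norm (x + y))\<^sup>2 = 1 + (norm x)\<^sup>2 + 2 * (x \<bullet> y)"
  using assms by (simp add: dot_norm field_simps)

text \<open>For \<open>norm y = 1\<close> the denominator is \<open>(norm (x + y))\<^sup>2\<close>.
  Splitting \<open>2 + 2 * (x \<bullet> y)\<close> into this denominator plus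
  \<open>1 - (norm x)\<^sup>2\<close> separates \<open>x\<close> from a rescaled inversion of
  \<open>x + y\<close>.\<close>

lemma moebius_sphere_eq:
  fixes x y :: "real ^ 'n"
  assumes "x \<in> ball 0 1" "y \<in> sphere 0 1"
  shows "ball_moebius x y = x + ((1 - (norm x)\<^sup>2) / (norm (x + y))\<^sup>2) *\<^sub>R (x + y)"
proof -
  define d where "d = 1 + 2 * (x \<bullet> y) + (norm x)\<^sup>2"
  have "0 < d"
    using moebius_denominator_pos[of x y] assms by (simp add: d_def)
  moreover have "(norm (x + y))\<^sup>2 = d"
    using norm_add_sphere_square[OF assms(2), of x] by (simp add: d_def)
  moreover have "ball_moebius x y
      = ((2 + 2 * (x \<bullet> y)) *\<^sub>R x + (1 - (norm x)\<^sup>2) *\<^sub>R y) /\<^sub>R d"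
    using assms by (simp add: ball_moebius_def d_def)
  moreover have "(2 + 2 * (x \<bullet> y)) *\<^sub>R x = d *\<^sub>R x + (1 - (norm x)\<^sup>2) *\<^sub>R x"
    by (simp add: d_def flip: scaleR_add_left)
  ultimately have "ball_moebius x y = (d *\<^sub>R x + (1 - (norm x)\<^sup>2) *\<^sub>R (x + y)) /\<^sub>R d"
    by (simp only: scaleR_add_right add.assoc)
  with \<open>0 < d\<close> \<open>(norm (x + y))\<^sup>2 = d\<close> show ?thesis
    by (simp only: scaleR_add_right[of "inverse d"]) (simp add: divide_inverse mult.commute)
qed

lemma norm_add_sphere_pos:
  fixes x y :: "'a :: real_normed_vector"
  assumes "x \<in> ball 0 1" "y \<in> sphere 0 1"
  shows "0 < norm (x + y)"
  using assms norm_triangle_ineq2[of y "- x"]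
  by (simp add: add.commute del: zero_less_norm_iff)

text \<open>Quantifies the concentration: for \<open>x\<close> close to the boundary, the image is
  close to \<open>x\<close> as long as \<open>y\<close> stays away from \<open>- x\<close>.\<close>

lemma norm_moebius_diff:
  fixes x y :: "real ^ 'n"
  assumes "x \<in> ball 0 1" "y \<in> sphere 0 1"
  shows "norm (ball_moebius x y - x) = (1 - (norm x)\<^sup>2) / norm (x + y)"
proof -
  have "(norm x)\<^sup>2 \<le> 1"
    using assms by (simp add: power_le_one)
  with norm_add_sphere_pos[OF assms] show ?thesis
    by (simp add: moebius_sphere_eq[OF assms] power2_eq_square)
qed

lemma
  assumes "sphere_measure \<mu>"
  shows sets_sphere_measure: "sets \<mu> = sets (restrict_space borel (sphere 0 1))"
    and space_sphere_measure: "space \<mu> = sphere 0 1"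
    and finite_sphere_measure: "finite_measure \<mu>"
    and measure_sphere_pos: "0 < measure \<mu> (sphere 0 1)"
proof -
  show sets: "sets \<mu> = sets (restrict_space borel (sphere 0 1))"
    using assms by (simp add: sphere_measure_def sphere_borel_def)
  show space: "space \<mu> = sphere 0 1"
    using sets_eq_imp_space_eq[OF sets] by (simp add: space_restrict_space)
  show "finite_measure \<mu>"
    by standard (use assms in \<open>auto simp: sphere_measure_def space\<close>)
  show "0 < measure \<mu> (sphere 0 1)"
    using assms by (auto simp: sphere_measure_def measure_def enn2real_positive_iff)
qed

lemma singleton_sphere_measure:
  assumes "sphere_measure \<mu>" "y \<in> sphere 0 1"
  shows "{y} \<in> sets \<mu>"
  using assms by (auto simp: sets_sphere_measure sets_restrict_space image_iff)

lemma measure_atom_less: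
  assumes "sphere_measure \<mu>" "atoms_below_half \<mu>"
  shows "measure \<mu> {y} < measure \<mu> (sphere 0 1) / 2"
proof (cases "y \<in> sphere 0 1")
  case True
  interpret finite_measure \<mu>
    by (rule finite_sphere_measure[OF assms(1)])
  have "ennreal (measure \<mu> {y}) < ennreal (measure \<mu> (sphere 0 1)) / 2"
    using assms(2) True by (simp add: atoms_below_half_def flip: emeasure_eq_measure)
  then have "ennreal (measure \<mu> {y}) < ennreal (measure \<mu> (sphere 0 1) / 2)"
    by (simp add: divide_ennreal flip: ennreal_numeral)
  then show ?thesis
    by (simp only: ennreal_less_iff measure_nonneg)
next
  case False
  \<comment> \<open>\<open>measure\<close> is zero by convention outside the sigma-algebra.\<close>
  then have "{y} \<notin> sets \<mu>"
    using sets.sets_into_space[of "{y}" \<mu>] by (auto simp: space_sphere_measure[OF assms(1)])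
  then show ?thesis
    using measure_sphere_pos[OF assms(1)] by (simp add: measure_notin_sets)
qed

lemma integrable_sphere_continuous:
  fixes f :: "real ^ 'n \<Rightarrow> 'b :: {banach, second_countable_topology}"
  assumes "sphere_measure \<mu>" "continuous_on (sphere 0 1) f"
  shows "integrable \<mu> f"
proof -
  interpret finite_measure \<mu>
    by (rule finite_sphere_measure[OF assms(1)])
  have "compact (f ` sphere 0 1)"
    using assms(2) by (rule compact_continuous_image) simp
  then obtain B where "\<And>y. y \<in> sphere 0 1 \<Longrightarrow> norm (f y) \<le> B"
    using compact_imp_bounded bounded_iff by (metis imageI)
  moreover have "f \<in> borel_measurable \<mu>"
    using borel_measurable_continuous_on_restrict[OF assms(2)]
    by (simp cong: measurable_cong_sets add: sets_sphere_measure[OF assms(1)])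
  ultimately show ?thesis
    by (intro integrable_const_bound[where B = B] AE_I2)
       (auto simp: space_sphere_measure[OF assms(1)])
qed

section \<open>Uniqueness of the center\<close>

lemma integral_moebius_inner:
  assumes "sphere_measure \<mu>" "x \<in> ball 0 1"
  shows "(LINT y|\<mu>. ball_moebius x y) \<bullet> v = (LINT y|\<mu>. ball_moebius x y \<bullet> v)"
  using integrable_moebius[OF assms] by simp

text \<open>Expanding \<open>(norm (x + y))\<^sup>2\<close> shows that a zero of the center-of-mass map determines the
  integrals of \<open>1 / (norm (x + y))\<^sup>2\<close> and \<open>y /\<^sub>R (norm (x + y))\<^sup>2\<close>.\<close>

lemma center_moments:
  fixes \<mu> :: "(real ^ 'n) measure"
  assumes \<mu>: "sphere_measure \<mu>" and x: "x \<in> ball 0 1"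
    and zero: "(LINT y|\<mu>. ball_moebius x y) = 0"
  shows "(1 - (norm x)\<^sup>2)\<^sup>2 * (LINT y|\<mu>. (c + v \<bullet> y) / (norm (x + y))\<^sup>2)
    = measure \<mu> (sphere 0 1) * (c * (1 + (norm x)\<^sup>2) - 2 * (v \<bullet> x))"
proof -
  define M where "M = measure \<mu> (sphere 0 1)"
  define \<alpha> where "\<alpha> = 1 - (norm x)\<^sup>2"
  define f where "f y = 1 / (norm (x + y))\<^sup>2" for y
  define h where "h v y = (v \<bullet> y) / (norm (x + y))\<^sup>2" for v y
  define I where "I = (LINT y|\<mu>. f y)"
  define J where "J v = (LINT y|\<mu>. h v y)" for v
  interpret finite_measure \<mu>
    by (rule finite_sphere_measure[OF \<mu>])
  note space = space_sphere_measure[OF \<mu>]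
  have ne: "x + y \<noteq> 0" if "y \<in> sphere 0 1" for y
    using norm_add_sphere_pos[OF x that] by auto
  have int: "integrable \<mu> f" "integrable \<mu> (h v)" for v
    using ne unfolding f_def h_def
    by (auto intro!: integrable_sphere_continuous[OF \<mu>] continuous_intros)
  \<comment> \<open>Test the zero equation against \<open>v\<close>, with the map in the form
    \<open>moebius_sphere_eq\<close>.\<close>
  have J: "\<alpha> * J v = - (M + \<alpha> * I) * (v \<bullet> x)" for v
  proof -
    have "0 = (LINT y|\<mu>. ball_moebius x y \<bullet> v)"
      using integral_moebius_inner[OF \<mu> x, of v] zero by simp
    also have "\<dots> = (LINT y|\<mu>. v \<bullet> x + \<alpha> * (v \<bullet> x) * f y + \<alpha> * h v y)"
      by (intro Bochner_Integration.integral_cong refl)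
         (simp add: space moebius_sphere_eq[OF x] f_def h_def \<alpha>_def inner_add_left inner_commute[of v]
           add_divide_distrib distrib_left)
    also have "\<dots> = M * (v \<bullet> x) + \<alpha> * (v \<bullet> x) * I + \<alpha> * J v"
      using int by (simp add: I_def J_def M_def space)
    finally show ?thesis
      by (simp add: algebra_simps)
  qed
  \<comment> \<open>Integrating \<open>1 = (norm (x + y))\<^sup>2 / (norm (x + y))\<^sup>2\<close>
    gives a second relation; together with \<open>J\<close> at \<open>v = x\<close> it determines
    \<open>I\<close>.\<close>
  have "M = (LINT y|\<mu>. (1 + (norm x)\<^sup>2) * f y + 2 * h x y)"
  proof -
    have "M = (LINT y|\<mu>. 1)"
      by (simp add: M_def space)
    also have "\<dots> = (LINT y|\<mu>. (1 + (norm x)\<^sup>2) * f y + 2 * h x y)"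
    proof (intro Bochner_Integration.integral_cong refl)
      fix y assume "y \<in> space \<mu>"
      then have y: "y \<in> sphere 0 1"
        by (simp add: space)
      have "(1 + (norm x)\<^sup>2) * f y + 2 * h x y = (norm (x + y))\<^sup>2 / (norm (x + y))\<^sup>2"
        by (simp only: f_def h_def norm_add_sphere_square[OF y, of x])
           (simp only: add_divide_distrib times_divide_eq_right mult_1_right)
      with ne[OF y] show "1 = (1 + (norm x)\<^sup>2) * f y + 2 * h x y"
        by simp
    qed
    finally show ?thesis .
  qed
  also have "\<dots> = (1 + (norm x)\<^sup>2) * I + 2 * J x"
    using int by (simp add: I_def J_def)
  finally have "\<alpha> * M = \<alpha> * (1 + (norm x)\<^sup>2) * I + 2 * (\<alpha> * J x)"
    by (simp add: algebra_simps)
  then have I: "\<alpha>\<^sup>2 * I = M * (1 + (norm x)\<^sup>2)"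
    unfolding J by (simp add: \<alpha>_def dot_square_norm power2_eq_square algebra_simps)
  have "\<alpha>\<^sup>2 * J v = \<alpha> * (\<alpha> * J v)"
    by (simp add: power2_eq_square)
  also have "\<dots> = - (\<alpha> * M + \<alpha>\<^sup>2 * I) * (v \<bullet> x)"
    unfolding J by (simp add: power2_eq_square algebra_simps)
  finally have "\<alpha>\<^sup>2 * J v = - (\<alpha> * M + \<alpha>\<^sup>2 * I) * (v \<bullet> x)" .
  then have "\<alpha>\<^sup>2 * J v = - 2 * M * (v \<bullet> x)"
    unfolding I by (simp add: \<alpha>_def algebra_simps)
  moreover have "(LINT y|\<mu>. (c + v \<bullet> y) / (norm (x + y))\<^sup>2)
      = (LINT y|\<mu>. c * f y + h v y)"
    by (simp add: f_def h_def add_divide_distrib)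
  then have "(LINT y|\<mu>. (c + v \<bullet> y) / (norm (x + y))\<^sup>2) = c * I + J v"
    using int by (simp add: I_def J_def)
  moreover have "\<alpha>\<^sup>2 * (c * I + J v) = c * (\<alpha>\<^sup>2 * I) + \<alpha>\<^sup>2 * J v"
    by (simp add: algebra_simps)
  ultimately have "\<alpha>\<^sup>2 * (LINT y|\<mu>. (c + v \<bullet> y) / (norm (x + y))\<^sup>2)
      = c * (M * (1 + (norm x)\<^sup>2)) - 2 * M * (v \<bullet> x)"
    using I by simp
  then show ?thesis
    unfolding M_def \<alpha>_def by (simp add: algebra_simps)
qed

text \<open>Measured from one intersection point \<open>p\<close>, the sphere equation is quadratic
  in the parameter shift \<open>t\<close> without constant term, so only one root besides
  \<open>t = 0\<close> remains.\<close>

lemma line_sphere_two_points: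
  fixes u w :: "'a :: real_inner"
  assumes "u \<noteq> 0"
  shows "\<exists>p q. {y \<in> sphere 0 1. \<exists>s. y = w + s *\<^sub>R u} \<subseteq> {p, q}"
proof (cases "\<exists>p \<in> sphere 0 1. \<exists>s. p = w + s *\<^sub>R u")
  case True
  then obtain p s where p: "p \<in> sphere 0 1" "p = w + s *\<^sub>R u"
    by blast
  have "y = p \<or> y = p - (2 * (p \<bullet> u) / (u \<bullet> u)) *\<^sub>R u"
    if y: "y \<in> sphere 0 1" "y = w + r *\<^sub>R u" for y r
  proof -
    define t where "t = r - s"
    have yp: "y = p + t *\<^sub>R u"
      by (simp add: t_def p(2) y(2) algebra_simps)
    have "y \<bullet> y = 1" "p \<bullet> p = 1"
      using y(1) p(1) by (simp_all flip: power2_norm_eq_inner)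
    then have "t * (2 * (p \<bullet> u) + t * (u \<bullet> u)) = 0"
      by (simp add: yp inner_add_left inner_add_right inner_commute[of u p] algebra_simps)
    then have "t = 0 \<or> t * (u \<bullet> u) = - (2 * (p \<bullet> u))"
      by (simp add: add_eq_0_iff)
    moreover have "u \<bullet> u \<noteq> 0"
      using assms by simp
    ultimately have "t = 0 \<or> t = - (2 * (p \<bullet> u)) / (u \<bullet> u)"
      by (metis nonzero_mult_div_cancel_right)
    then show ?thesis
      using yp by auto
  qed
  then have "{y \<in> sphere 0 1. \<exists>s. y = w + s *\<^sub>R u}
      \<subseteq> {p, p - (2 * (p \<bullet> u) / (u \<bullet> u)) *\<^sub>R u}"
    by auto
  then show ?thesis
    by (intro exI)
next
  case False
  \<comment> \<open>The set is empty here, and \<open>w\<close> is a mere placeholder.\<close>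
  then have "{y \<in> sphere 0 1. \<exists>s. y = w + s *\<^sub>R u} \<subseteq> {w, w}"
    by auto
  then show ?thesis
    by (intro exI)
qed

text \<open>These vectors are half the Klein model coordinates of \<open>x\<close> and
  \<open>z\<close>. Cross-multiplying their norms leaves a multiple of
  \<open>1 - norm x * norm z\<close>, which is positive in the ball.\<close>

lemma klein_coordinates_inj:
  fixes x z :: "'a :: real_normed_vector"
  assumes "x \<in> ball 0 1" "z \<in> ball 0 1"
    and eq: "x /\<^sub>R (1 + (norm x)\<^sup>2) = z /\<^sub>R (1 + (norm z)\<^sup>2)"
  shows "x = z"
proof -
  have pos: "0 < 1 + (norm x)\<^sup>2" "0 < 1 + (norm z)\<^sup>2"
    by (simp_all add: add_pos_nonneg)
  have "norm x / (1 + (norm x)\<^sup>2) = norm z / (1 + (norm z)\<^sup>2)"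
    using arg_cong[OF eq, of norm] pos by (simp add: divide_inverse mult.commute)
  then have "norm x * (1 + (norm z)\<^sup>2) = norm z * (1 + (norm x)\<^sup>2)"
    using pos by (simp add: frac_eq_eq less_imp_neq[symmetric])
  then have "(norm x - norm z) * (1 - norm x * norm z) = 0"
    by algebra
  moreover have "norm x * norm z < 1"
    using assms mult_strict_mono'[of "norm x" 1 "norm z" 1] by simp
  ultimately have "norm x = norm z"
    by simp
  with eq pos show ?thesis
    by simp
qed

text \<open>The point \<open>x\<close> lifts to the vector \<open>(1 + (norm x)\<^sup>2, 2 *\<^sub>R x)\<close> of Minkowski space, whose
  pairing with the null vector \<open>(1, y)\<close> is \<open>(norm (x + y))\<^sup>2\<close>. The left-hand side is minus the
  Lorentz square of a combination of two such lifts that is orthogonal to \<open>(1, y)\<close>.\<close>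

lemma lorentz_identity:
  fixes x y z :: "'a :: real_inner"
  assumes y: "norm y = 1"
  defines "A \<equiv> (norm (x + y))\<^sup>2" and "B \<equiv> (norm (z + y))\<^sup>2"
  shows "2 * ((1 + (norm x)\<^sup>2) * (1 + (norm z)\<^sup>2) - 4 * (x \<bullet> z)) * A * B
      - (1 - (norm x)\<^sup>2)\<^sup>2 * B\<^sup>2 - (1 - (norm z)\<^sup>2)\<^sup>2 * A\<^sup>2
    = (norm ((2 * B) *\<^sub>R x - (2 * A) *\<^sub>R z
        + (B * (1 + (norm x)\<^sup>2) - A * (1 + (norm z)\<^sup>2)) *\<^sub>R y))\<^sup>2"
proof -
  have yy: "y \<bullet> y = 1"
    using y by (simp flip: power2_norm_eq_inner)
  define a where "a = x \<bullet> x"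
  define b where "b = z \<bullet> z"
  define p where "p = x \<bullet> y"
  define q where "q = z \<bullet> y"
  define c where "c = x \<bullet> z"
  note comm = inner_commute[of y x] inner_commute[of y z] inner_commute[of z x]
  have AB: "A = 1 + a + 2 * p" "B = 1 + b + 2 * q"
    by (simp_all add: A_def B_def power2_norm_eq_inner inner_add_left inner_add_right yy comm
        a_def b_def p_def q_def)
  \<comment> \<open>Orthogonality to the null vector: it turns the cross term of the square below
    into \<open>- 2 * e\<^sup>2\<close>, so that \<open>e\<^sup>2\<close> ends up with the
    Lorentzian sign.\<close>
  have ort: "2 * B * p - 2 * A * q + (B * (1 + a) - A * (1 + b)) = 0"
    unfolding AB by (simp add: algebra_simps)
  define e where "e = B * (1 + a) - A * (1 + b)"
  have sq: "(norm ((2 * B) *\<^sub>R x - (2 * A) *\<^sub>R z + e *\<^sub>R y))\<^sup>2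
     = 4 * B\<^sup>2 * a + 4 * A\<^sup>2 * b - 8 * A * B * c + e\<^sup>2 + 2 * e * (2 * B * p - 2 * A * q)"
    unfolding power2_norm_eq_inner
    by (simp add: inner_add_left inner_add_right inner_diff_left inner_diff_right yy comm
        a_def[symmetric] b_def[symmetric] p_def[symmetric] q_def[symmetric] c_def[symmetric])
       (simp add: power2_eq_square algebra_simps)
  have "2 * B * p - 2 * A * q = - e"
    using ort by (simp add: e_def)
  then have "(norm ((2 * B) *\<^sub>R x - (2 * A) *\<^sub>R z + e *\<^sub>R y))\<^sup>2
     = 4 * B\<^sup>2 * a + 4 * A\<^sup>2 * b - 8 * A * B * c - e\<^sup>2"
    unfolding sq by (simp add: power2_eq_square)
  then show ?thesis
    unfolding power2_norm_eq_inner[of x] power2_norm_eq_inner[of z]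
      a_def[symmetric] b_def[symmetric] c_def[symmetric] e_def[symmetric]
    by (simp add: e_def power2_eq_square algebra_simps)
qed

text \<open>Two atoms, each below half of the mass, cannot add up to the total mass.\<close>

lemma not_concentrated_on_two_points:
  assumes \<mu>: "sphere_measure \<mu>" "atoms_below_half \<mu>"
  shows "\<not> (AE y in \<mu>. y \<in> {p, q})"
proof
  assume AE: "AE y in \<mu>. y \<in> {p, q}"
  interpret finite_measure \<mu>
    by (rule finite_sphere_measure[OF \<mu>(1)])
  \<comment> \<open>Intersecting with the sphere also covers points \<open>r\<close> off the sphere,
    where the set is empty.\<close>
  have *: "{r} \<inter> sphere 0 1 \<in> sets \<mu>" "measure \<mu> ({r} \<inter> sphere 0 1) < measure \<mu> (sphere 0 1) / 2"
    for r
    using measure_atom_less[OF \<mu>, of r] measure_sphere_pos[OF \<mu>(1)]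
      singleton_sphere_measure[OF \<mu>(1), of r]
    by (cases "r \<in> sphere 0 1"; simp)+
  have top: "sphere 0 1 \<in> sets \<mu>"
    using sets.top[of \<mu>] by (simp add: space_sphere_measure[OF \<mu>(1)])
  have "measure \<mu> (sphere 0 1) = measure \<mu> (({p} \<inter> sphere 0 1) \<union> ({q} \<inter> sphere 0 1))"
    using AE by (intro measure_eq_AE sets.Un * top) (auto elim!: eventually_mono)
  also have "\<dots> \<le> measure \<mu> ({p} \<inter> sphere 0 1) + measure \<mu> ({q} \<inter> sphere 0 1)"
    using * by (intro measure_Un_le)
  finally show False
    using *(2)[of p] *(2)[of q] by simp
qed

text \<open>The moments at \<open>x\<close> give the integral of \<open>B / A\<close>, those at
  \<open>z\<close> the integral of \<open>A / B\<close>, both through the symmetric quantity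
  \<open>\<gamma>\<close>. The resulting \<open>g\<close> is nonnegative with integral zero, hence
  zero almost everywhere; its zeros lie on a line, so the measure would sit on two points.\<close>

lemma center_unique:
  fixes \<mu> :: "(real ^ 'n) measure"
  assumes \<mu>: "sphere_measure \<mu>" "atoms_below_half \<mu>"
    and x: "x \<in> ball 0 1" "(LINT y|\<mu>. ball_moebius x y) = 0"
    and z: "z \<in> ball 0 1" "(LINT y|\<mu>. ball_moebius z y) = 0"
  shows "x = z"
proof (rule ccontr)
  assume "x \<noteq> z"
  interpret finite_measure \<mu>
    by (rule finite_sphere_measure[OF \<mu>(1)])
  note space = space_sphere_measure[OF \<mu>(1)]
  define k where "k = x /\<^sub>R (1 + (norm x)\<^sup>2)"
  define l where "l = z /\<^sub>R (1 + (norm z)\<^sup>2)"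
  have kl: "l - k \<noteq> 0"
    using klein_coordinates_inj[OF x(1) z(1)] \<open>x \<noteq> z\<close> by (auto simp: k_def l_def)
  define A where "A y = (norm (x + y))\<^sup>2" for y
  define B where "B y = (norm (z + y))\<^sup>2" for y
  define \<gamma> where "\<gamma> = (1 + (norm x)\<^sup>2) * (1 + (norm z)\<^sup>2) - 4 * (x \<bullet> z)"
  have pos: "0 < A y" "0 < B y" if "y \<in> sphere 0 1" for y
    using norm_add_sphere_pos[OF x(1) that] norm_add_sphere_pos[OF z(1) that]
    by (simp_all add: A_def B_def)
  have cont: "continuous_on (sphere 0 1) A" "continuous_on (sphere 0 1) B"
    unfolding A_def B_def by (intro continuous_intros)+
  have int: "integrable \<mu> (\<lambda>y. B y / A y)" "integrable \<mu> (\<lambda>y. A y / B y)"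
    using pos by (intro integrable_sphere_continuous[OF \<mu>(1)] continuous_intros cont; force)+
  have BA: "(1 - (norm x)\<^sup>2)\<^sup>2 * (LINT y|\<mu>. B y / A y) = measure \<mu> (sphere 0 1) * \<gamma>"
  proof -
    have "(LINT y|\<mu>. B y / A y)
        = (LINT y|\<mu>. (1 + (norm z)\<^sup>2 + (2 *\<^sub>R z) \<bullet> y) / (norm (x + y))\<^sup>2)"
      by (intro Bochner_Integration.integral_cong refl)
         (simp add: space A_def B_def norm_add_sphere_square)
    then show ?thesis
      using center_moments[OF \<mu>(1) x, of "1 + (norm z)\<^sup>2" "2 *\<^sub>R z"]
      by (simp add: \<gamma>_def inner_commute mult.commute)
  qed
  have AB: "(1 - (norm z)\<^sup>2)\<^sup>2 * (LINT y|\<mu>. A y / B y) = measure \<mu> (sphere 0 1) * \<gamma>"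
  proof -
    have "(LINT y|\<mu>. A y / B y)
        = (LINT y|\<mu>. (1 + (norm x)\<^sup>2 + (2 *\<^sub>R x) \<bullet> y) / (norm (z + y))\<^sup>2)"
      by (intro Bochner_Integration.integral_cong refl)
         (simp add: space A_def B_def norm_add_sphere_square)
    then show ?thesis
      using center_moments[OF \<mu>(1) z, of "1 + (norm x)\<^sup>2" "2 *\<^sub>R x"]
      by (simp add: \<gamma>_def)
  qed
  \<comment> \<open>The left-hand side of \<open>lorentz_identity\<close> divided by
    \<open>A y * B y\<close>, so that the moment equations apply.\<close>
  define g where
    "g y = 2 * \<gamma> - (1 - (norm x)\<^sup>2)\<^sup>2 * (B y / A y) - (1 - (norm z)\<^sup>2)\<^sup>2 * (A y / B y)" for y
  define W where "W y = (2 * B y) *\<^sub>R x - (2 * A y) *\<^sub>R z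
        + (B y * (1 + (norm x)\<^sup>2) - A y * (1 + (norm z)\<^sup>2)) *\<^sub>R y" for y
  have g: "g y * (A y * B y) = (norm (W y))\<^sup>2" if "y \<in> sphere 0 1" for y
  proof -
    have "g y * (A y * B y)
        = 2 * \<gamma> * A y * B y - (1 - (norm x)\<^sup>2)\<^sup>2 * (B y)\<^sup>2 - (1 - (norm z)\<^sup>2)\<^sup>2 * (A y)\<^sup>2"
      using pos[OF that] by (simp add: g_def field_simps power2_eq_square)
    then show ?thesis
      using that lorentz_identity[of y x z] by (simp add: \<gamma>_def A_def B_def W_def)
  qed
  \<comment> \<open>The two quotients each contribute \<open>\<gamma>\<close> times the mass and
    cancel \<open>2 * \<gamma>\<close>.\<close>
  have "(LINT y|\<mu>. g y) = 0"
    using int by (simp add: g_def AB BA space del: times_divide_eq_right)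
  moreover have "0 \<le> g y" if "y \<in> sphere 0 1" for y
    using g[OF that] pos[OF that] by (metis mult_pos_pos zero_le_mult_iff zero_le_power2 not_less)
  moreover have "integrable \<mu> g"
    unfolding g_def using int by (simp del: times_divide_eq_right)
  ultimately have ae: "AE y in \<mu>. g y = 0"
    by (subst integral_nonneg_eq_0_iff_AE[symmetric]) (auto simp: space)
  \<comment> \<open>Geodesics are chords in the Klein model: this is the line through
    \<open>- 2 *\<^sub>R l\<close> and \<open>- 2 *\<^sub>R k\<close>, the Klein points of
    \<open>- z\<close> and \<open>- x\<close>.\<close>
  obtain p q where
    pq: "{y \<in> sphere 0 1. \<exists>s. y = - 2 *\<^sub>R l + s *\<^sub>R (l - k)} \<subseteq> {p, q}"
    using line_sphere_two_points[OF kl] by blast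
  have two: "y \<in> {p, q}" if y: "y \<in> sphere 0 1" and "g y = 0" for y
  proof -
    define a where "a = A y * (1 + (norm z)\<^sup>2)"
    define b where "b = B y * (1 + (norm x)\<^sup>2)"
    have ab: "0 < a" "0 < b"
      using pos[OF y] by (simp_all add: a_def b_def add_pos_nonneg)
    have "W y = 0"
      using g[OF y] \<open>g y = 0\<close> by simp
    moreover have "(1 + (norm x)\<^sup>2) \<noteq> 0" "(1 + (norm z)\<^sup>2) \<noteq> 0"
      by (simp_all add: add_pos_nonneg less_imp_neq[symmetric])
    then have "(2 * B y) *\<^sub>R x = (2 * b) *\<^sub>R k" "(2 * A y) *\<^sub>R z = (2 * a) *\<^sub>R l"
      by (simp_all add: a_def b_def k_def l_def)
    then have "W y = (2 * b) *\<^sub>R k - (2 * a) *\<^sub>R l + (b - a) *\<^sub>R y"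
      by (simp only: W_def a_def b_def)
    ultimately have eq: "(b - a) *\<^sub>R y = (2 * a) *\<^sub>R l - (2 * b) *\<^sub>R k"
      by (simp add: algebra_simps)
    have "b \<noteq> a"
    proof
      assume "b = a"
      then have "(2 * a) *\<^sub>R (l - k) = 0"
        using eq by (auto simp: algebra_simps)
      with kl ab show False
        by simp
    qed
    \<comment> \<open>Obtained by rewriting the right-hand side of \<open>eq\<close> as
      \<open>- 2 * (b - a)\<close> times \<open>l\<close> plus \<open>2 * b\<close> times
      \<open>l - k\<close>.\<close>
    define t where "t = 2 * b / (b - a)"
    have t: "(b - a) * t = 2 * b"
      using \<open>b \<noteq> a\<close> by (simp add: t_def)
    have "(b - a) *\<^sub>R (- 2 *\<^sub>R l + t *\<^sub>R (l - k)) = (b - a) *\<^sub>R y"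
      unfolding eq scaleR_add_right[of "b - a"] scaleR_scaleR t by (simp add: algebra_simps)
    then have "y = - 2 *\<^sub>R l + t *\<^sub>R (l - k)"
      using \<open>b \<noteq> a\<close> by (simp only: scaleR_cancel_left) auto
    with y pq show ?thesis
      by blast
  qed
  have "AE y in \<mu>. y \<in> {p, q}"
    using ae AE_space by eventually_elim (use two in \<open>simp add: space\<close>)
  with not_concentrated_on_two_points[OF \<mu>] show False
    by blast
qed

section \<open>Weak convergence with a moving point of the ball\<close>

lemma tendsto_total_mass:
  assumes "sphere_weak_conv \<mu>s \<mu>" "sphere_measure \<mu>" "\<And>k. sphere_measure (\<mu>s k)"
  shows "(\<lambda>k. measure (\<mu>s k) (sphere 0 1)) \<longlonglongrightarrow> measure \<mu> (sphere 0 1)"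
proof -
  have "(\<lambda>k. LINT y|\<mu>s k. (1 :: real)) \<longlonglongrightarrow> (LINT y|\<mu>. 1)"
    using assms(1) unfolding sphere_weak_conv_def by (elim allE[where x = "\<lambda>_. 1"]) auto
  then show ?thesis
    by (simp add: space_sphere_measure assms)
qed

lemma uniform_limit_moebius:
  fixes x :: "nat \<Rightarrow> real ^ 'n"
  assumes "x \<longlonglongrightarrow> z" "z \<in> ball 0 1"
  shows "uniform_limit (sphere 0 1) (\<lambda>k. ball_moebius (x k)) (ball_moebius z) sequentially"
proof -
  \<comment> \<open>Staying in \<open>cball 0 r\<close> with \<open>r < 1\<close> keeps the
    denominator positive on a compact product, where joint continuity is uniform.\<close>
  obtain r where r: "norm z < r" "r < 1"
    using assms(2) dense[of "norm z" 1] by auto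
  have "continuous_on (cball 0 r \<times> sphere 0 1) (\<lambda>v. ball_moebius (fst v) (snd v) :: real ^ 'n)"
    unfolding ball_moebius_def
  proof (intro continuous_intros ballI)
    fix v :: "(real ^ 'n) \<times> (real ^ 'n)" assume "v \<in> cball 0 r \<times> sphere 0 1"
    with r moebius_denominator_pos[of "fst v" "snd v"]
    show "1 + 2 * (fst v \<bullet> snd v) + (norm (fst v))\<^sup>2 * (norm (snd v))\<^sup>2 \<noteq> 0"
      by auto
  qed
  then have "uniformly_continuous_on (cball 0 r \<times> sphere 0 1)
      (\<lambda>v. ball_moebius (fst v) (snd v) :: real ^ 'n)"
    by (rule compact_uniformly_continuous) (intro compact_Times compact_cball compact_sphere)
  note uc = this[unfolded uniformly_continuous_on_def, rule_format]
  show ?thesis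
  proof (rule uniform_limitI)
    fix e :: real assume "0 < e"
    from uc[OF this] obtain d where d: "0 < d"
      "\<And>p q. p \<in> cball 0 r \<times> sphere 0 1 \<Longrightarrow> q \<in> cball 0 r \<times> sphere 0 1 \<Longrightarrow> dist q p < d \<Longrightarrow>
        dist (ball_moebius (fst q) (snd q) :: real ^ 'n) (ball_moebius (fst p) (snd p)) < e"
      by blast
    have "\<forall>\<^sub>F k in sequentially. dist (x k) z < d"
      using assms(1) d(1) by (rule tendstoD)
    moreover have "\<forall>\<^sub>F k in sequentially. norm (x k) < r"
      using tendsto_norm[OF assms(1)] r(1) by (rule order_tendstoD)
    ultimately show "\<forall>\<^sub>F k in sequentially. \<forall>y\<in>sphere 0 1.
        dist (ball_moebius (x k) y) (ball_moebius z y) < e"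
    proof eventually_elim
      case (elim k)
      show ?case
      proof
        fix y :: "real ^ 'n" assume "y \<in> sphere 0 1"
        with elim r show "dist (ball_moebius (x k) y) (ball_moebius z y) < e"
          using d(2)[of "(z, y)" "(x k, y)"] by (simp add: dist_Pair_Pair)
      qed
    qed
  qed
qed

text \<open>Integrand and measure both vary. Replacing \<open>x k\<close> by \<open>z\<close> costs
  at most the mass times a uniform error; what remains is weak convergence for a fixed
  integrand.\<close>

lemma tendsto_integral_moebius:
  fixes \<mu> :: "(real ^ 'n) measure"
  assumes wc: "sphere_weak_conv \<mu>s \<mu>" and \<mu>: "sphere_measure \<mu>"
    and \<mu>s: "\<And>k. sphere_measure (\<mu>s k)"
    and x: "\<And>k. x k \<in> ball 0 1" "x \<longlonglongrightarrow> z" "z \<in> ball 0 1"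
  shows "(\<lambda>k. LINT y|\<mu>s k. ball_moebius (x k) y) \<longlonglongrightarrow> (LINT y|\<mu>. ball_moebius z y)"
proof -
  have diff: "(\<lambda>k. (LINT y|\<mu>s k. ball_moebius (x k) y) - (LINT y|\<mu>s k. ball_moebius z y)) \<longlonglongrightarrow> 0"
  proof (rule tendstoI)
    fix e :: real assume e: "0 < e"
    \<comment> \<open>An eventual bound for the masses, by their convergence.\<close>
    define M where "M = measure \<mu> (sphere 0 1) + 1"
    have M: "0 < M"
      by (simp add: M_def add_nonneg_pos)
    have "\<forall>\<^sub>F k in sequentially. measure (\<mu>s k) (sphere 0 1) < M"
      using tendsto_total_mass[OF wc \<mu> \<mu>s] by (rule order_tendstoD) (simp add: M_def)
    moreover have "\<forall>\<^sub>F k in sequentially. \<forall>y\<in>sphere 0 1.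
        dist (ball_moebius (x k) y) (ball_moebius z y) < e / M"
      using uniform_limitD[OF uniform_limit_moebius[OF x(2,3)], of "e / M"] e M by simp
    ultimately show "\<forall>\<^sub>F k in sequentially.
        dist ((LINT y|\<mu>s k. ball_moebius (x k) y) - (LINT y|\<mu>s k. ball_moebius z y)) 0 < e"
    proof eventually_elim
      case (elim k)
      interpret finite_measure "\<mu>s k"
        by (rule finite_sphere_measure[OF \<mu>s])
      note space = space_sphere_measure[OF \<mu>s[of k]]
      have int: "integrable (\<mu>s k) (\<lambda>y. ball_moebius (x k) y - ball_moebius z y)"
        by (intro Bochner_Integration.integrable_diff integrable_moebius \<mu>s x)
      have "norm ((LINT y|\<mu>s k. ball_moebius (x k) y) - (LINT y|\<mu>s k. ball_moebius z y))
          = norm (LINT y|\<mu>s k. ball_moebius (x k) y - ball_moebius z y)"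
        by (subst Bochner_Integration.integral_diff) (auto intro!: integrable_moebius \<mu>s x)
      also have "\<dots> \<le> (LINT y|\<mu>s k. norm (ball_moebius (x k) y - ball_moebius z y))"
        by (rule integral_norm_bound)
      also have "\<dots> \<le> (LINT y|\<mu>s k. e / M)"
        using elim(2) int
        by (intro integral_mono integrable_norm) (auto simp: space dist_norm intro: less_imp_le)
      also have "\<dots> = measure (\<mu>s k) (sphere 0 1) * (e / M)"
        by (simp add: space)
      also have "\<dots> < M * (e / M)"
        using elim(1) e M by (intro mult_strict_right_mono) auto
      finally show ?case
        using M by simp
    qed
  qed
  have cont: "continuous_on (sphere 0 1) (ball_moebius z)"
    using continuous_on_moebius[OF x(3)] by (rule continuous_on_subset) auto
  have "(\<lambda>k. LINT y|\<mu>s k. ball_moebius z y) \<longlonglongrightarrow> (LINT y|\<mu>. ball_moebius z y)"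
  \<comment> \<open>Weak convergence tests real functions only, so the vector integral is treated
    componentwise.\<close>
  proof (subst tendsto_componentwise_iff, rule ballI)
    fix b :: "real ^ 'n"
    have "continuous_on (sphere 0 1) (\<lambda>y. ball_moebius z y \<bullet> b)"
      by (intro continuous_intros cont)
    with wc have "(\<lambda>k. LINT y|\<mu>s k. ball_moebius z y \<bullet> b) \<longlonglongrightarrow> (LINT y|\<mu>. ball_moebius z y \<bullet> b)"
      by (simp add: sphere_weak_conv_def)
    then show "(\<lambda>k. (LINT y|\<mu>s k. ball_moebius z y) \<bullet> b) \<longlonglongrightarrow> (LINT y|\<mu>. ball_moebius z y) \<bullet> b"
      by (simp only: integral_moebius_inner \<mu> \<mu>s x)
  qed
  from tendsto_add[OF diff this] show ?thesis
    by simp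
qed

section \<open>Behaviour near the boundary sphere\<close>

text \<open>The cutoffs are continuous, equal to \<open>- 1\<close> near \<open>- p\<close> and to
  \<open>1\<close> away from it. As \<open>j\<close> grows they tend to
  \<open>1 - 2 * indicator {- p}\<close>, whose integral is positive by the atom condition.\<close>

lemma atom_cutoff:
  fixes \<mu> :: "(real ^ 'n) measure"
  assumes \<mu>: "sphere_measure \<mu>" "atoms_below_half \<mu>" and p: "p \<in> sphere 0 1"
  obtains j :: nat where
    "0 < (LINT y|\<mu>. max (- 1) (min 1 (real j * norm (y + p) - 2)))" "0 < j"
proof -
  interpret finite_measure \<mu>
    by (rule finite_sphere_measure[OF \<mu>(1)])
  note space = space_sphere_measure[OF \<mu>(1)]
  define \<psi> where "\<psi> j y = max (- 1) (min 1 (real j * norm (y + p) - 2))" for j :: nat and y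
  have mp: "{- p} \<in> sets \<mu>"
    using singleton_sphere_measure[OF \<mu>(1), of "- p"] p by simp
  have "(\<lambda>j. LINT y|\<mu>. \<psi> j y) \<longlonglongrightarrow> (LINT y|\<mu>. 1 - 2 * indicator {- p} y)"
  proof (rule integral_dominated_convergence)
    show "(\<lambda>y. 1 - 2 * indicator {- p} y :: real) \<in> borel_measurable \<mu>"
      using mp by simp
    show "\<psi> j \<in> borel_measurable \<mu>" for j
      unfolding \<psi>_def
      by (intro borel_measurable_integrable integrable_sphere_continuous[OF \<mu>(1)] continuous_intros)
    show "integrable \<mu> (\<lambda>_. 1 :: real)"
      by simp
    show "AE y in \<mu>. norm (\<psi> j y) \<le> 1" for j
      by (auto simp: \<psi>_def abs_le_iff)
    show "AE y in \<mu>. (\<lambda>j. \<psi> j y) \<longlonglongrightarrow> 1 - 2 * indicator {- p} y"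
    proof (intro AE_I2)
      fix y
      show "(\<lambda>j. \<psi> j y) \<longlonglongrightarrow> 1 - 2 * indicator {- p} y"
      proof (cases "y = - p")
        case True
        then show ?thesis
          by (simp add: \<psi>_def)
      next
        case False
        then have "0 < norm (y + p)"
          by (simp add: add_eq_0_iff2)
        \<comment> \<open>Above \<open>3\<close> the inner \<open>min\<close> is capped at
          \<open>1\<close>.\<close>
        then obtain N :: nat where N: "3 < real N * norm (y + p)"
          using ex_less_of_nat_mult by blast
        have "\<psi> j y = 1" if "N \<le> j" for j
        proof -
          have "real N * norm (y + p) \<le> real j * norm (y + p)"
            using that by (intro mult_right_mono) auto
          with N show ?thesis
            by (simp add: \<psi>_def)
        qed
        then have "\<forall>\<^sub>F j in sequentially. \<psi> j y = 1"
          by (auto simp: eventually_sequentially)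
        then have "(\<lambda>j. \<psi> j y) \<longlonglongrightarrow> 1"
          by (rule tendsto_eventually)
        with False show ?thesis
          by simp
      qed
    qed
  qed
  moreover have "(LINT y|\<mu>. 1 - 2 * indicator {- p} y)
      = measure \<mu> (sphere 0 1) - 2 * measure \<mu> {- p}"
    using mp p by (subst Bochner_Integration.integral_diff)
      (auto simp: space emeasure_eq_measure)
  moreover have "0 < measure \<mu> (sphere 0 1) - 2 * measure \<mu> {- p}"
    using measure_atom_less[OF \<mu>, of "- p"] by simp
  ultimately have "\<forall>\<^sub>F j in sequentially. 0 < (LINT y|\<mu>. \<psi> j y)"
    by (auto intro: order_tendstoD)
  then have "\<forall>\<^sub>F j in sequentially. 0 < (LINT y|\<mu>. \<psi> j y) \<and> 0 < j"
    using eventually_gt_at_top[of 0] by eventually_elim simp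
  then obtain j where "0 < (LINT y|\<mu>. \<psi> j y)" "0 < j"
    using eventually_happens trivial_limit_sequentially by blast
  with that show ?thesis
    by (simp add: \<psi>_def)
qed

text \<open>The integrand is bounded below by the fixed continuous \<open>\<psi>\<close> minus
  \<open>\<epsilon> k\<close>, which tends to zero. Weak convergence then carries the positive
  integral of \<open>\<psi>\<close> over to the measures \<open>\<mu>s k\<close>.\<close>

lemma radial_integral_eventually_pos:
  fixes \<mu> :: "(real ^ 'n) measure"
  assumes wc: "sphere_weak_conv \<mu>s \<mu>" and \<mu>: "sphere_measure \<mu>" "atoms_below_half \<mu>"
    and \<mu>s: "\<And>k. sphere_measure (\<mu>s k)"
    and x: "\<And>k. x k \<in> ball 0 1" "x \<longlonglongrightarrow> p" "p \<in> sphere 0 1"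
  shows "\<forall>\<^sub>F k in sequentially. 0 < (LINT y|\<mu>s k. ball_moebius (x k) y) \<bullet> x k"
proof -
  obtain j :: nat where
    j: "0 < (LINT y|\<mu>. max (- 1) (min 1 (real j * norm (y + p) - 2)))" "0 < j"
    using atom_cutoff[OF \<mu> x(3)] .
  define \<psi> where "\<psi> y = max (- 1) (min 1 (real j * norm (y + p) - 2))" for y
  define \<alpha> where "\<alpha> k = 1 - (norm (x k))\<^sup>2" for k
  \<comment> \<open>One \<open>\<alpha> k\<close> is the defect of \<open>x k \<bullet> x k\<close>
    from \<open>1\<close>; \<open>2 * real j * \<alpha> k\<close> bounds the distance of the image
    from \<open>x k\<close> in the far case below.\<close>
  define \<epsilon> where "\<epsilon> k = \<alpha> k * (1 + 2 * real j)" for k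
  have cont: "continuous_on (sphere 0 1) \<psi>"
    unfolding \<psi>_def by (intro continuous_intros)
  have "\<alpha> \<longlonglongrightarrow> 1 - (norm p)\<^sup>2"
    unfolding \<alpha>_def by (intro tendsto_intros x)
  then have "\<epsilon> \<longlonglongrightarrow> (1 - (norm p)\<^sup>2) * (1 + 2 * real j)"
    unfolding \<epsilon>_def by (intro tendsto_intros)
  then have "(\<lambda>k. (LINT y|\<mu>s k. \<psi> y) - measure (\<mu>s k) (sphere 0 1) * \<epsilon> k)
      \<longlonglongrightarrow> (LINT y|\<mu>. \<psi> y) - measure \<mu> (sphere 0 1) * ((1 - (norm p)\<^sup>2) * (1 + 2 * real j))"
    using wc cont unfolding sphere_weak_conv_def
    by (intro tendsto_diff tendsto_mult tendsto_total_mass[OF wc \<mu>(1) \<mu>s]) auto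
  then have "\<forall>\<^sub>F k in sequentially. 0 < (LINT y|\<mu>s k. \<psi> y) - measure (\<mu>s k) (sphere 0 1) * \<epsilon> k"
    using j x(3) by (intro order_tendstoD(1)) (auto simp: \<psi>_def)
  moreover have "\<forall>\<^sub>F k in sequentially. dist (x k) p < 1 / (2 * real j)"
    using x(2) j(2) by (intro tendstoD) auto
  ultimately show ?thesis
  proof eventually_elim
    case (elim k)
    interpret finite_measure "\<mu>s k"
      by (rule finite_sphere_measure[OF \<mu>s])
    note space = space_sphere_measure[OF \<mu>s[of k]]
    have nx: "norm (x k) < 1"
      using x(1)[of k] by simp
    then have \<alpha>: "0 \<le> \<alpha> k"
      by (simp add: \<alpha>_def power_le_one)
    have bound: "\<psi> y - \<epsilon> k \<le> ball_moebius (x k) y \<bullet> x k" if y: "y \<in> sphere 0 1" for y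
    \<comment> \<open>Near \<open>- p\<close> the cutoff is \<open>- 1\<close>, a trivial lower
      bound; elsewhere the image is close to \<open>x k\<close>.\<close>
    proof (cases "norm (y + p) \<le> 1 / real j")
      case True
      then have "\<psi> y = - 1"
        using j(2) by (simp add: \<psi>_def field_simps)
      moreover have "\<bar>ball_moebius (x k) y \<bullet> x k\<bar> \<le> 1 * 1"
        using norm_moebius_sphere[OF x(1) y, of k] nx
        by (intro order_trans[OF Cauchy_Schwarz_ineq2] mult_mono) auto
      moreover have "0 \<le> \<epsilon> k"
        using \<alpha> by (simp add: \<epsilon>_def)
      ultimately show ?thesis
        by (simp add: abs_le_iff)
    next
      case False
      have "norm (y + p) \<le> norm (x k + y) + dist (x k) p"
        using norm_triangle_ineq[of "x k + y" "p - x k"]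
        by (simp add: dist_norm norm_minus_commute algebra_simps)
      \<comment> \<open>Half of the distance \<open>1 / real j\<close> survives the replacement of
        \<open>p\<close> by \<open>x k\<close>.\<close>
      then have far: "1 / (2 * real j) \<le> norm (x k + y)"
        using False elim(2) by (simp add: field_simps)
      then have "\<alpha> k / norm (x k + y) \<le> \<alpha> k / (1 / (2 * real j))"
        using \<alpha> j(2) norm_add_sphere_pos[OF x(1) y, of k] by (intro divide_left_mono) auto
      then have "norm (ball_moebius (x k) y - x k) \<le> 2 * real j * \<alpha> k"
        by (simp add: norm_moebius_diff[OF x(1) y] \<alpha>_def mult.commute)
      then have "\<bar>(ball_moebius (x k) y - x k) \<bullet> x k\<bar> \<le> (2 * real j * \<alpha> k) * 1"
        using nx \<alpha> by (intro order_trans[OF Cauchy_Schwarz_ineq2] mult_mono) auto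
      moreover have "ball_moebius (x k) y \<bullet> x k = (ball_moebius (x k) y - x k) \<bullet> x k + (1 - \<alpha> k)"
        by (simp add: inner_diff_left \<alpha>_def power2_norm_eq_inner)
      moreover have "\<psi> y \<le> 1"
        by (simp add: \<psi>_def)
      moreover have "\<epsilon> k = \<alpha> k + 2 * real j * \<alpha> k"
        by (simp add: \<epsilon>_def algebra_simps)
      ultimately show ?thesis
        by linarith
    qed
    have int: "integrable (\<mu>s k) \<psi>"
      by (intro integrable_sphere_continuous \<mu>s cont)
    have "(LINT y|\<mu>s k. \<psi> y) - measure (\<mu>s k) (sphere 0 1) * \<epsilon> k = (LINT y|\<mu>s k. \<psi> y - \<epsilon> k)"
      using int by (simp add: space)
    also have "\<dots> \<le> (LINT y|\<mu>s k. ball_moebius (x k) y \<bullet> x k)"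
      using bound int integrable_moebius[OF \<mu>s x(1)]
      by (intro integral_mono integrable_inner_left) (auto simp: space)
    also have "\<dots> = (LINT y|\<mu>s k. ball_moebius (x k) y) \<bullet> x k"
      by (rule integral_moebius_inner[OF \<mu>s x(1), symmetric])
    finally show ?case
      using elim(1) by simp
  qed
qed

section \<open>Existence by Brouwer's theorem\<close>

lemma center_exists:
  fixes \<mu> :: "(real ^ 'n) measure"
  assumes \<mu>: "sphere_measure \<mu>" "atoms_below_half \<mu>"
  shows "\<exists>x \<in> ball 0 1. (LINT y|\<mu>. ball_moebius x y) = 0"
proof (rule ccontr)
  assume none: "\<not> ?thesis"
  define F where "F x = (LINT y|\<mu>. ball_moebius x y)" for x
  \<comment> \<open>The constant sequence makes the lemmas on weakly convergent measures available
    for \<open>\<mu>\<close> alone.\<close>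
  have wc: "sphere_weak_conv (\<lambda>_. \<mu>) \<mu>"
    by (simp add: sphere_weak_conv_def)
  have nz: "F x \<noteq> 0" if "x \<in> ball 0 1" for x
    using none that by (auto simp: F_def)
  have cont: "continuous_on (ball 0 1) F"
    unfolding continuous_on_sequentially F_def comp_def
    using tendsto_integral_moebius[OF wc \<mu>(1) \<mu>(1)] by auto
  \<comment> \<open>Otherwise points with \<open>F x \<bullet> x \<le> 0\<close> on spheres of
    radius tending to \<open>1\<close> accumulate at the boundary, against
    \<open>radial_integral_eventually_pos\<close>.\<close>
  have "\<exists>r. 0 < r \<and> r < 1 \<and> (\<forall>x \<in> sphere 0 r. 0 < F x \<bullet> x)"
  proof (rule ccontr)
    assume contra: "\<not> ?thesis"
    \<comment> \<open>The double \<open>Suc\<close> makes the radius positive already at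
      \<open>k = 0\<close>.\<close>
    define r where "r k = 1 + - inverse (real (Suc (Suc k)))" for k
    have "0 < r k \<and> r k < 1" for k
      by (simp add: r_def field_simps)
    with contra have "\<forall>k. \<exists>x. x \<in> sphere 0 (r k) \<and> F x \<bullet> x \<le> 0"
      by (meson not_less)
    then obtain x where x: "\<And>k. x k \<in> sphere 0 (r k)" "\<And>k. F (x k) \<bullet> x k \<le> 0"
      by metis
    have xb: "x k \<in> ball 0 1" for k
      using x(1)[of k] by (simp add: r_def)
    have "\<forall>k. x k \<in> cball 0 1"
      using xb by (simp add: less_imp_le)
    then obtain p s where s: "strict_mono s" "(x \<circ> s) \<longlonglongrightarrow> p"
      using compact_cball[of "0 :: real ^ 'n" 1] unfolding compact_def by blast
    have "r \<longlonglongrightarrow> 1"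
      unfolding r_def by (rule LIMSEQ_Suc[OF LIMSEQ_inverse_real_of_nat_add_minus])
    then have "(\<lambda>k. norm ((x \<circ> s) k)) \<longlonglongrightarrow> 1"
      using LIMSEQ_subseq_LIMSEQ[OF _ s(1), of r 1] x(1) by (simp add: comp_def)
    then have p: "p \<in> sphere 0 1"
      using LIMSEQ_unique[OF tendsto_norm[OF s(2)]] by simp
    have "\<forall>\<^sub>F k in sequentially. 0 < F ((x \<circ> s) k) \<bullet> (x \<circ> s) k"
      unfolding F_def
      by (rule radial_integral_eventually_pos[OF wc \<mu> \<mu>(1) _ s(2) p]) (simp only: comp_apply xb)
    then show False
      using x(2) by (auto simp: eventually_sequentially not_less[symmetric])
  qed
  then obtain r where r: "0 < r" "r < 1" "\<And>x. x \<in> sphere 0 r \<Longrightarrow> 0 < F x \<bullet> x"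
    by auto
  \<comment> \<open>A fixed point of \<open>G\<close> has norm \<open>r\<close> and points against
    \<open>F x\<close>, contradicting outwardness on \<open>sphere 0 r\<close>.\<close>
  define G where "G x = - (r / norm (F x)) *\<^sub>R F x" for x
  have sub: "cball 0 r \<subseteq> (ball 0 1 :: (real ^ 'n) set)"
    using r by auto
  have "continuous_on (cball 0 r) G"
    unfolding G_def using nz sub
    by (intro continuous_intros continuous_on_subset[OF cont]) auto
  moreover have nG: "norm (G x) = r" if "x \<in> cball 0 r" for x
    using nz[of x] sub that r by (auto simp: G_def)
  ultimately obtain x where x: "x \<in> cball 0 r" "G x = x"
    using brouwer[of "cball 0 r" G] r(1) by auto
  have "F x \<bullet> x = - (r / norm (F x)) * (F x \<bullet> F x)"
    by (subst x(2)[symmetric]) (simp add: G_def)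
  also have "\<dots> \<le> 0"
    using r(1) by simp
  finally show False
    using r(3)[of x] nG[OF x(1)] x by simp
qed

section \<open>Continuous dependence of the center on the measure\<close>

lemma center_ex1:
  fixes \<mu> :: "(real ^ 'n) measure"
  assumes "sphere_measure \<mu>" "atoms_below_half \<mu>"
  shows "\<exists>!x. x \<in> ball 0 1 \<and> (LINT y|\<mu>. ball_moebius x y) = 0"
  using center_exists[OF assms] center_unique[OF assms] by blast

lemma
  fixes \<mu> :: "(real ^ 'n) measure"
  assumes "sphere_measure \<mu>" "atoms_below_half \<mu>"
  shows moebius_center_in_ball: "moebius_center \<mu> \<in> ball 0 1"
    and integral_moebius_center: "(LINT y|\<mu>. ball_moebius (moebius_center \<mu>) y) = 0"
  using theI'[OF center_ex1[OF assms]] by (simp_all add: moebius_center_def)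

lemma sphere_weak_conv_subseq:
  assumes "sphere_weak_conv \<mu>s \<mu>" "strict_mono s"
  shows "sphere_weak_conv (\<mu>s \<circ> s) \<mu>"
  unfolding sphere_weak_conv_def
proof (intro allI impI)
  fix \<psi> :: "real ^ 'a \<Rightarrow> real" assume "continuous_on (sphere 0 1) \<psi>"
  with assms(1) have "(\<lambda>k. LINT y|\<mu>s k. \<psi> y) \<longlonglongrightarrow> (LINT y|\<mu>. \<psi> y)"
    by (simp add: sphere_weak_conv_def)
  from LIMSEQ_subseq_LIMSEQ[OF this assms(2)]
  show "(\<lambda>k. LINT y|(\<mu>s \<circ> s) k. \<psi> y) \<longlonglongrightarrow> (LINT y|\<mu>. \<psi> y)"
    by (simp add: comp_def)
qed

text \<open>The integrals at the centers vanish, so their radial parts are not positive and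
  \<open>p\<close> cannot lie on the sphere. Inside the ball the zero equation passes to the limit,
  and uniqueness applies.\<close>

lemma moebius_center_limit:
  fixes \<mu> :: "(real ^ 'n) measure"
  assumes wc: "sphere_weak_conv \<mu>s \<mu>" and \<mu>: "sphere_measure \<mu>" "atoms_below_half \<mu>"
    and \<mu>s: "\<And>k. sphere_measure (\<mu>s k)" "\<And>k. atoms_below_half (\<mu>s k)"
    and lim: "(\<lambda>k. moebius_center (\<mu>s k)) \<longlonglongrightarrow> p"
  shows "p = moebius_center \<mu>"
proof -
  note xb = moebius_center_in_ball[OF \<mu>s] and zero = integral_moebius_center[OF \<mu>s]
  have "p \<in> cball 0 1"
    by (rule closed_sequentially[OF closed_cball _ lim]) (use xb in \<open>simp add: less_imp_le\<close>)
  moreover have "p \<notin> sphere 0 1"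
    using radial_integral_eventually_pos[OF wc \<mu> \<mu>s(1) xb lim] by (auto simp: zero)
  ultimately have p: "p \<in> ball 0 1"
    by auto
  have "(\<lambda>k. 0) \<longlonglongrightarrow> (LINT y|\<mu>. ball_moebius p y)"
    using tendsto_integral_moebius[OF wc \<mu>(1) \<mu>s(1) xb lim p] by (simp add: zero)
  then have "(LINT y|\<mu>. ball_moebius p y) = 0"
    by (simp add: LIMSEQ_const_iff)
  with p center_unique[OF \<mu>] moebius_center_in_ball[OF \<mu>] integral_moebius_center[OF \<mu>]
  show ?thesis
    by blast
qed

lemma moebius_center_continuous:
  fixes \<mu> :: "(real ^ 'n) measure"
  assumes wc: "sphere_weak_conv \<mu>s \<mu>" and \<mu>: "sphere_measure \<mu>" "atoms_below_half \<mu>"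
    and \<mu>s: "\<And>k. sphere_measure (\<mu>s k)" "\<And>k. atoms_below_half (\<mu>s k)"
  shows "(\<lambda>k. moebius_center (\<mu>s k)) \<longlonglongrightarrow> moebius_center \<mu>"
proof (rule ccontr)
  assume "\<not> ?thesis"
  then obtain e where e: "0 < e"
    "\<not> (\<forall>\<^sub>F k in sequentially. dist (moebius_center (\<mu>s k)) (moebius_center \<mu>) < e)"
    unfolding tendsto_iff by blast
  \<comment> \<open>A subsequence staying \<open>e\<close> away from the center has a convergent
    subsequence, whose limit must nevertheless be the center.\<close>
  then obtain s :: "nat \<Rightarrow> nat" where s: "strict_mono s"
    "\<And>k. \<not> dist (moebius_center (\<mu>s (s k))) (moebius_center \<mu>) < e"
    using not_eventually_sequentiallyD[OF e(2)] by blast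
  define x where "x k = moebius_center (\<mu>s (s k))" for k
  have "\<forall>k. x k \<in> cball 0 1"
    using moebius_center_in_ball[OF \<mu>s] by (simp add: x_def less_imp_le)
  then obtain p t where t: "strict_mono t" "(x \<circ> t) \<longlonglongrightarrow> p"
    using compact_cball[of "0 :: real ^ 'n" 1] unfolding compact_def by blast
  have "p = moebius_center \<mu>"
  proof (rule moebius_center_limit[OF _ \<mu>])
    show "sphere_weak_conv (\<mu>s \<circ> (s \<circ> t)) \<mu>"
      by (intro sphere_weak_conv_subseq[OF wc] strict_mono_o s t)
  qed (use t(2) \<mu>s in \<open>simp_all add: comp_def x_def\<close>)
  with t(2) e(1) have "\<forall>\<^sub>F k in sequentially.
      dist (moebius_center (\<mu>s (s (t k)))) (moebius_center \<mu>) < e"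
    by (auto simp: comp_def x_def dest: tendstoD)
  with s(2) show False
    by (auto simp: eventually_sequentially)
qed

section \<open>Center of mass of the pushforward\<close>

lemma integral_distr_moebius:
  assumes "sphere_measure \<mu>" "x \<in> ball 0 1"
  shows "(LINT y|distr \<mu> sphere_borel (ball_moebius x). y) = (LINT y|\<mu>. ball_moebius x y)"
proof (rule integral_distr)
  show "ball_moebius x \<in> measurable \<mu> sphere_borel"
    using measurable_moebius[OF assms(2)] assms(1)
    by (simp add: sphere_measure_def cong: measurable_cong_sets)
  show "(\<lambda>y. y) \<in> borel_measurable sphere_borel"
    by (simp add: sphere_borel_def measurable_restrict_space1)
qed

theorem corollary5:
  fixes \<mu> :: "(real ^ 'n) measure"
  assumes "2 \<le> CARD('n)"
    and "sphere_measure \<mu>"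
    and "atoms_below_half \<mu>"
  shows "(\<exists>!x. x \<in> ball 0 1 \<and> (LINT y|\<mu>. ball_moebius x y) = 0) \<and>
    (\<forall>x \<in> ball 0 1. (LINT y|\<mu>. ball_moebius x y) = 0 \<longleftrightarrow>
       (LINT y|distr \<mu> sphere_borel (ball_moebius x). y) = 0) \<and>
    (\<forall>\<mu>s :: nat \<Rightarrow> (real ^ 'n) measure.
       (\<forall>k. sphere_measure (\<mu>s k) \<and> atoms_below_half (\<mu>s k)) \<longrightarrow>
       sphere_weak_conv \<mu>s \<mu> \<longrightarrow>
       (\<lambda>k. moebius_center (\<mu>s k)) \<longlonglongrightarrow> moebius_center \<mu>)"
  using center_ex1[OF assms(2,3)] integral_distr_moebius[OF assms(2)]
    moebius_center_continuous[OF _ assms(2,3)]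
  by auto

end
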